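(* Consider the $[pqrs]$ random walk on $\{0,1,2,\dots\}$ described in the context. The expected time $m_i$ before absorption when starting in $i$ is $$m_i=\frac{1-s}{s}-v_1^{-1}\left(1-\frac{s_0}{s}\right)\xi_1^{1-i}\qquad(i=0,1,2,\dots).$$
   Context: The walk: let $p,q,s>0$, $r\ge0$, $p+q+r+s=1$. In each state $n\ge1$, at each time step the particle moves to $n+1$ with probability $p$, moves to $n-1$ with probability $q$, stays in $n$ with probability $r$, or is absorbed in $n$ (removed) with probability $s$. In state $0$ it moves to $1$ with probability $p_0$, stays with probability $r_0$, is absorbed with probability $s_0$, where $p_0,s_0>0$, $r_0\ge0$, $p_0+r_0+s_0=1$. The time before absorption is the number of steps (forward, backward, or staying) made before the absorption; the absorption event itself is not counted as a step. Thus, e.g., $(1-r_0)m_0=p_0m_1+1-s_0$. Notation: $$\xi_1=\frac{(1-r)+\sqrt{(1-r)^2-4pq}}{2q},\qquad v_1=p_0-(1-r_0)\xi_1 .$$ *)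

theory Defs
  imports "HOL-Probability.Probability"
begin

text \<open>
  A time-homogeneous Markov chain with discrete state space, transition probabilities \<open>K\<close> and
  initial state \<open>x0\<close>, realised as a process \<open>X\<close> on a probability space \<open>M\<close>. The transition
  condition is imposed for every history of positive probability.
\<close>

definition markov_chain ::
  "('s \<Rightarrow> 's \<Rightarrow> real) \<Rightarrow> 's \<Rightarrow> 'w measure \<Rightarrow> (nat \<Rightarrow> 'w \<Rightarrow> 's) \<Rightarrow> bool"
where
  "markov_chain K x0 M X \<longleftrightarrow>
     prob_space M \<and>
     (\<forall>n. X n \<in> measurable M (count_space UNIV)) \<and>
     (AE \<omega> in M. X 0 \<omega> = x0) \<and>
     (\<forall>n h y. \<P>(\<omega> in M. \<forall>k\<le>n. X k \<omega> = h k) > 0 \<longrightarrow>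
        \<P>(\<omega> in M. X (Suc n) \<omega> = y \<bar> \<forall>k\<le>n. X k \<omega> = h k) = K (h n) y)"

text \<open>
  The state \<open>Some n\<close> is the particle being alive in \<open>n\<close>; \<open>None\<close> means that it has been absorbed.
\<close>

fun pqrs_trans ::
  "real \<Rightarrow> real \<Rightarrow> real \<Rightarrow> real \<Rightarrow> real \<Rightarrow> real \<Rightarrow> real \<Rightarrow> nat option \<Rightarrow> nat option \<Rightarrow> real"
where
  "pqrs_trans p q r s p0 r0 s0 None y = (if y = None then 1 else 0)"
| "pqrs_trans p q r s p0 r0 s0 (Some 0) y =
     (if y = Some 1 then p0
      else if y = Some 0 then r0
      else if y = None then s0
      else 0)"
| "pqrs_trans p q r s p0 r0 s0 (Some (Suc n)) y =
     (if y = Some (Suc (Suc n)) then p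
      else if y = Some n then q
      else if y = Some (Suc n) then r
      else if y = None then s
      else 0)"

text \<open>
  The number of steps made before absorption. The absorption event is not counted: if \<open>Suc n\<close> is
  the first time at which the particle is in the state \<open>None\<close>, then exactly \<open>n\<close> steps were made.
  The value is \<open>\<infinity>\<close> (the infimum of the empty set) if the particle is never absorbed.
\<close>

definition time_before_absorption :: "(nat \<Rightarrow> 'w \<Rightarrow> 'a option) \<Rightarrow> 'w \<Rightarrow> enat" where
  "time_before_absorption X \<omega> = Inf {enat n | n. X (Suc n) \<omega> = None}"

definition expected_time_before_absorption ::
  "'w measure \<Rightarrow> (nat \<Rightarrow> 'w \<Rightarrow> 'a option) \<Rightarrow> ennreal"
where
  "expected_time_before_absorption M X =
     (\<integral>\<^sup>+ \<omega>. ennreal_of_enat (time_before_absorption X \<omega>) \<partial>M)"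

definition xi1 :: "real \<Rightarrow> real \<Rightarrow> real \<Rightarrow> real" where
  "xi1 p q r = ((1 - r) + sqrt ((1 - r)\<^sup>2 - 4 * p * q)) / (2 * q)"

definition v1 :: "real \<Rightarrow> real \<Rightarrow> real \<Rightarrow> real \<Rightarrow> real \<Rightarrow> real" where
  "v1 p q r p0 r0 = p0 - (1 - r0) * xi1 p q r"

end

theory Submission
  imports Defs
begin

text \<open>
  The mean number of steps is the sum over \<open>n \<ge> 1\<close> of the probability that the particle is still alive
  at time \<open>n\<close>. Write \<open>A n\<close> for the probability of being alive at all times up to \<open>n\<close>, and let \<open>u\<close> be a
  bounded nonnegative solution of the first-step equation
  \<open>u x = (\<Sum>y alive. K x y * (1 + u y))\<close>. Averaging this equation over the position at time \<open>n\<close>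
  gives \<open>U n = A (Suc n) + U (Suc n)\<close>, where \<open>U n\<close> is the mean of \<open>u\<close> at that position, with the
  value 0 where the particle has not survived up to \<open>n\<close>. Telescoping from \<open>U 0 = u x0\<close> yields
  \<open>(\<Sum>k<n. A (Suc k)) + U n = u x0\<close>. The left sum is thus bounded, so \<open>A\<close> tends to 0; as \<open>u\<close> is bounded
  by some \<open>C\<close>, also \<open>U n \<le> C * A n\<close> tends to 0, and the sum of the \<open>A (Suc k)\<close> is \<open>u x0\<close>
  (\<open>suminf_confined_prob\<close>).

  The averaging step is the only place where the Markov property enters. It is given for complete
  histories, and \<open>confined_mass_Suc\<close> obtains the recursion for one-dimensional marginals by summing over
  the countably many histories that stay alive.

  For the walk, the first-step equation is a linear recurrence of order two with one boundary condition.
  The constant \<open>(1 - s) / s\<close> is a particular solution, and the homogeneous solutions are spanned by the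
  powers \<open>x ^ i\<close> with \<open>p * x\<^sup>2 - (1 - r) * x + q = 0\<close>. One root is \<open>1 / xi1 < 1\<close>, the other exceeds 1.
  Hence only the powers of \<open>1 / xi1\<close> are bounded, and the boundary condition at 0 fixes their coefficient.
\<close>

section \<open>Paths that stay in a countable set\<close>

lemma pred_confined:
  assumes m: "\<And>n. X n \<in> measurable M (count_space UNIV)"
  shows "Measurable.pred M (\<lambda>\<omega>. \<forall>k\<le>n::nat. X k \<omega> \<in> S)"
  by (intro pred_intros_countable(1) pred_intros_imp' measurable_compose[OF m]) simp

definition confined_mass ::
  "'w measure \<Rightarrow> (nat \<Rightarrow> 'w \<Rightarrow> 's) \<Rightarrow> 's set \<Rightarrow> nat \<Rightarrow> 's \<Rightarrow> ennreal"
where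
  "confined_mass M X S n x = emeasure M {\<omega> \<in> space M. (\<forall>k\<le>n. X k \<omega> \<in> S) \<and> X n \<omega> = x}"

text \<open>
  The Markov property in product form. It also covers histories of probability zero, so that sums over
  histories need no case distinction.
\<close>

lemma markov_chain_extend_history:
  fixes K :: "'s \<Rightarrow> 's \<Rightarrow> real"
  assumes mc: "markov_chain K x0 M X" and K: "K (h n) y \<ge> 0"
  shows "emeasure M {\<omega> \<in> space M. (\<forall>k\<le>n. X k \<omega> = h k) \<and> X (Suc n) \<omega> = y} =
    emeasure M {\<omega> \<in> space M. \<forall>k\<le>n. X k \<omega> = h k} * ennreal (K (h n) y)"
    (is "emeasure M ?B = emeasure M ?A * _")
proof -
  interpret prob_space M using mc by (simp add: markov_chain_def)
  have meas[measurable]: "\<And>n. X n \<in> measurable M (count_space UNIV)"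
    using mc by (simp add: markov_chain_def)
  show ?thesis
  proof (cases "prob ?A = 0")
    case True
    then have "emeasure M ?A = 0" by (simp add: emeasure_eq_measure)
    moreover have "emeasure M ?B \<le> emeasure M ?A" by (rule emeasure_mono) auto
    ultimately show ?thesis by simp
  next
    case False
    then have "prob ?A > 0" using measure_nonneg[of M ?A] by linarith
    then have "\<P>(\<omega> in M. X (Suc n) \<omega> = y \<bar> \<forall>k\<le>n. X k \<omega> = h k) = K (h n) y"
      using mc by (simp add: markov_chain_def)
    moreover have "{\<omega> \<in> space M. X (Suc n) \<omega> = y \<and> (\<forall>k\<le>n. X k \<omega> = h k)} = ?B" by auto
    ultimately have "prob ?B = prob ?A * K (h n) y"
      using False by (simp add: cond_prob_def field_simps)
    then show ?thesis
      using K by (simp add: emeasure_eq_measure ennreal_mult)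
  qed
qed

text \<open>
  Both sides are sums over histories that stay in \<open>S\<close>: there are only countably many of a given
  length, they describe disjoint events, and the Markov property extends each of them by the same
  factor \<open>K x y\<close> that depends on its last state only.
\<close>

lemma confined_mass_Suc:
  fixes K :: "'s \<Rightarrow> 's \<Rightarrow> real"
  assumes mc: "markov_chain K x0 M X" and K: "\<And>x y. K x y \<ge> 0"
    and S: "countable S" and y: "y \<in> S"
  shows "confined_mass M X S (Suc n) y =
    (\<integral>\<^sup>+x. confined_mass M X S n x * ennreal (K x y) \<partial>count_space S)"
proof -
  have meas[measurable]: "\<And>n. X n \<in> measurable M (count_space UNIV)"
    using mc by (simp add: markov_chain_def)
  have step: "emeasure M {\<omega> \<in> space M. (\<forall>k\<le>n. X k \<omega> \<in> S) \<and> X n \<omega> = x \<and> X (Suc n) \<omega> = y} =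
      confined_mass M X S n x * ennreal (K x y)" if "x \<in> S" for x
  proof -
    \<comment> \<open>A history is a list with the state at time \<open>k\<close> in position \<open>k\<close>, hence of length \<open>Suc n\<close>.\<close>
    define H where "H = {l. l \<in> lists S \<and> length l = Suc n \<and> l ! n = x}"
    define E where "E l = {\<omega> \<in> space M. \<forall>k\<le>n. X k \<omega> = l ! k}" for l
    define F where "F l = {\<omega> \<in> space M. (\<forall>k\<le>n. X k \<omega> = l ! k) \<and> X (Suc n) \<omega> = y}" for l
    have H: "countable H"
      using countable_lists[OF S] by (rule countable_subset[rotated]) (auto simp: H_def)
    have EF: "E l \<in> sets M" "F l \<in> sets M" for l by (auto simp: E_def F_def)
    have disj: "disjoint_family_on E H" "disjoint_family_on F H"
      by (auto simp: disjoint_family_on_def E_def F_def H_def list_eq_iff_nth_eq less_Suc_eq_le)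
    have ex: "\<exists>l\<in>H. \<forall>k\<le>n. X k \<omega> = l ! k" if "\<forall>k\<le>n. X k \<omega> \<in> S" "X n \<omega> = x" for \<omega>
      by (rule bexI[of _ "map (\<lambda>k. X k \<omega>) [0..<Suc n]"])
         (use that in \<open>auto simp: H_def less_Suc_eq_le nth_append simp del: upt_Suc\<close>)
    have cylinder: "(\<forall>k\<le>n. X k \<omega> \<in> S) \<and> X n \<omega> = x \<longleftrightarrow> (\<exists>l\<in>H. \<forall>k\<le>n. X k \<omega> = l ! k)" for \<omega>
      using ex[of \<omega>] by (auto simp: H_def in_lists_conv_set)
    have UE: "(\<Union>l\<in>H. E l) = {\<omega> \<in> space M. (\<forall>k\<le>n. X k \<omega> \<in> S) \<and> X n \<omega> = x}"
      unfolding E_def cylinder by auto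
    have UF: "(\<Union>l\<in>H. F l) =
        {\<omega> \<in> space M. (\<forall>k\<le>n. X k \<omega> \<in> S) \<and> X n \<omega> = x \<and> X (Suc n) \<omega> = y}"
      unfolding F_def conj_assoc[symmetric] cylinder by auto
    have "emeasure M (\<Union>l\<in>H. F l) = (\<integral>\<^sup>+l. emeasure M (F l) \<partial>count_space H)"
      by (rule emeasure_UN_countable[OF EF(2) H disj(2)])
    also have "\<dots> = (\<integral>\<^sup>+l. emeasure M (E l) * ennreal (K x y) \<partial>count_space H)"
    proof (rule nn_integral_cong)
      fix l assume "l \<in> space (count_space H)"
      then have "l ! n = x" by (simp add: H_def)
      then show "emeasure M (F l) = emeasure M (E l) * ennreal (K x y)"
        using markov_chain_extend_history[OF mc, of "\<lambda>k. l ! k" n y] K by (simp add: E_def F_def)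
    qed
    also have "\<dots> = emeasure M (\<Union>l\<in>H. E l) * ennreal (K x y)"
      by (subst nn_integral_multc) (auto simp: emeasure_UN_countable[OF EF(1) H disj(1)])
    finally show ?thesis by (simp add: UE UF confined_mass_def)
  qed
  have "{\<omega> \<in> space M. (\<forall>k\<le>Suc n. X k \<omega> \<in> S) \<and> X (Suc n) \<omega> = y} =
      (\<Union>x\<in>S. {\<omega> \<in> space M. (\<forall>k\<le>n. X k \<omega> \<in> S) \<and> X n \<omega> = x \<and> X (Suc n) \<omega> = y})"
    using y unfolding le_Suc_eq all_simps disj_imp by blast
  moreover have "emeasure M (\<Union>x\<in>S. {\<omega> \<in> space M. (\<forall>k\<le>n. X k \<omega> \<in> S) \<and> X n \<omega> = x \<and> X (Suc n) \<omega> = y})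
      = (\<integral>\<^sup>+x. emeasure M
      {\<omega> \<in> space M. (\<forall>k\<le>n. X k \<omega> \<in> S) \<and> X n \<omega> = x \<and> X (Suc n) \<omega> = y} \<partial>count_space S)"
  proof (rule emeasure_UN_countable)
    show "{\<omega> \<in> space M. (\<forall>k\<le>n. X k \<omega> \<in> S) \<and> X n \<omega> = x \<and> X (Suc n) \<omega> = y} \<in> sets M" for x
      unfolding pred_def[symmetric] by (intro pred_intros_logic(3) pred_confined meas) measurable
  qed (auto simp: S disjoint_family_on_def)
  ultimately have "confined_mass M X S (Suc n) y = (\<integral>\<^sup>+x. emeasure M
      {\<omega> \<in> space M. (\<forall>k\<le>n. X k \<omega> \<in> S) \<and> X n \<omega> = x \<and> X (Suc n) \<omega> = y} \<partial>count_space S)"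
    by (simp only: confined_mass_def)
  also have "\<dots> = (\<integral>\<^sup>+x. confined_mass M X S n x * ennreal (K x y) \<partial>count_space S)"
    by (intro nn_integral_cong) (simp add: step)
  finally show ?thesis .
qed

text \<open>
  First-step analysis for the mean number of steps inside \<open>S\<close>. Boundedness of \<open>u\<close> singles out the right
  solution: it forces the remainder \<open>U n\<close> of the telescoping sum to vanish.
\<close>

lemma suminf_confined_prob:
  fixes K :: "'s \<Rightarrow> 's \<Rightarrow> real" and u :: "'s \<Rightarrow> ennreal"
  assumes mc: "markov_chain K x0 M X" and K: "\<And>x y. K x y \<ge> 0"
    and S: "countable S" and x0: "x0 \<in> S"
    and bdd: "\<And>x. x \<in> S \<Longrightarrow> u x \<le> ennreal C"
    and eq: "\<And>x. x \<in> S \<Longrightarrow> u x = (\<integral>\<^sup>+y. ennreal (K x y) * (1 + u y) \<partial>count_space S)"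
  shows "(\<Sum>n. emeasure M {\<omega> \<in> space M. \<forall>k\<le>Suc n. X k \<omega> \<in> S}) = u x0"
proof -
  interpret prob_space M using mc by (simp add: markov_chain_def)
  have meas[measurable]: "\<And>n. X n \<in> measurable M (count_space UNIV)"
    using mc by (simp add: markov_chain_def)
  let ?m = "confined_mass M X S"
  define A where "A n = emeasure M {\<omega> \<in> space M. \<forall>k\<le>n. X k \<omega> \<in> S}" for n
  define U where "U n = (\<integral>\<^sup>+x. ?m n x * u x \<partial>count_space S)" for n
  have A: "A n = (\<integral>\<^sup>+x. ?m n x \<partial>count_space S)" for n
  proof -
    have "{\<omega> \<in> space M. \<forall>k\<le>n. X k \<omega> \<in> S} =
        (\<Union>x\<in>S. {\<omega> \<in> space M. (\<forall>k\<le>n. X k \<omega> \<in> S) \<and> X n \<omega> = x})" by auto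
    moreover have "emeasure M (\<Union>x\<in>S. {\<omega> \<in> space M. (\<forall>k\<le>n. X k \<omega> \<in> S) \<and> X n \<omega> = x})
        = (\<integral>\<^sup>+x. ?m n x \<partial>count_space S)"
      unfolding confined_mass_def
    proof (rule emeasure_UN_countable)
      show "{\<omega> \<in> space M. (\<forall>k\<le>n. X k \<omega> \<in> S) \<and> X n \<omega> = x} \<in> sets M" for x
        unfolding pred_def[symmetric] by (intro pred_intros_logic(3) pred_confined meas) measurable
    qed (auto simp: S disjoint_family_on_def)
    ultimately show ?thesis by (simp only: A_def)
  qed
  \<comment> \<open>The first-step equation, averaged over the position at time \<open>n\<close>.\<close>
  have step: "U n = A (Suc n) + U (Suc n)" for n
  proof -
    have "U n = (\<integral>\<^sup>+x. \<integral>\<^sup>+y. ?m n x * (ennreal (K x y) * (1 + u y)) \<partial>count_space S \<partial>count_space S)"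
      unfolding U_def by (intro nn_integral_cong) (simp add: eq nn_integral_cmult)
    also have "\<dots> = (\<integral>\<^sup>+y. \<integral>\<^sup>+x. ?m n x * (ennreal (K x y) * (1 + u y)) \<partial>count_space S \<partial>count_space S)"
      by (rule nn_integral_count_space_nn_integral) (auto simp: S)
    also have "\<dots> = (\<integral>\<^sup>+y. ?m (Suc n) y * (1 + u y) \<partial>count_space S)"
      by (intro nn_integral_cong)
         (simp add: confined_mass_Suc[OF mc K S] nn_integral_multc mult.assoc[symmetric])
    also have "\<dots> = A (Suc n) + U (Suc n)"
      unfolding A U_def by (simp add: distrib_left nn_integral_add)
    finally show ?thesis .
  qed
  have U0: "U 0 = u x0"
  proof -
    have AE0: "AE \<omega> in M. X 0 \<omega> = x0" using mc by (simp add: markov_chain_def)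
    have sets0: "{\<omega> \<in> space M. (\<forall>k\<le>0. X k \<omega> \<in> S) \<and> X 0 \<omega> = x} \<in> sets M" for x
      unfolding pred_def[symmetric] by (intro pred_intros_logic(3) pred_confined meas) measurable
    have "?m 0 x = indicator {x0} x" for x
    proof (cases "x = x0")
      case True
      have "?m 0 x = emeasure M (space M)"
        unfolding confined_mass_def by (rule emeasure_eq_AE) (use AE0 x0 True sets0 in auto)
      then show ?thesis using True by (simp add: emeasure_space_1)
    next
      case False
      have "?m 0 x = emeasure M {}"
        unfolding confined_mass_def by (rule emeasure_eq_AE) (use AE0 x0 False sets0 in auto)
      then show ?thesis using False by simp
    qed
    then have "U 0 = (\<integral>\<^sup>+x. u x * indicator {x0} x \<partial>count_space S)"
      unfolding U_def by (simp add: mult.commute)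
    also have "\<dots> = u x0" using x0 by (subst nn_integral_indicator_singleton) auto
    finally show ?thesis .
  qed
  have partial_sums: "(\<Sum>k<n. A (Suc k)) + U n = u x0" for n
    by (induction n) (simp_all add: U0 add.assoc step[symmetric])
  have "(\<Sum>k. A (Suc k)) \<le> u x0"
  proof (rule suminf_le_const)
    show "(\<Sum>k<n. A (Suc k)) \<le> u x0" for n
      unfolding partial_sums[of n, symmetric] by simp
  qed auto
  also have "\<dots> < \<infinity>"
    using bdd[OF x0] by (rule le_less_trans) simp
  finally have fin: "(\<Sum>k. A (Suc k)) < \<infinity>" .
  \<comment> \<open>The terms of a convergent series tend to zero.\<close>
  have "A \<longlonglongrightarrow> 0"
  proof -
    have Aprob: "A n = ennreal (prob {\<omega> \<in> space M. \<forall>k\<le>n. X k \<omega> \<in> S})" for n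
      by (simp add: A_def emeasure_eq_measure)
    have "summable (\<lambda>n. prob {\<omega> \<in> space M. \<forall>k\<le>Suc n. X k \<omega> \<in> S})"
      using fin unfolding Aprob by (intro summable_suminf_not_top) auto
    from summable_LIMSEQ_zero[OF this]
    have "(\<lambda>n. A (Suc n)) \<longlonglongrightarrow> 0"
      unfolding Aprob by (simp flip: ennreal_0 add: tendsto_ennreal_iff)
    then show ?thesis by (simp add: filterlim_sequentially_Suc)
  qed
  then have CA: "(\<lambda>n. ennreal C * A n) \<longlonglongrightarrow> 0"
    using ennreal_tendsto_cmult[of "ennreal C" A 0] by simp
  have "U n \<le> ennreal C * A n" for n
    unfolding U_def A
    by (subst nn_integral_cmult[symmetric])
       (auto intro!: nn_integral_mono mult_right_mono bdd simp: mult.commute[of _ "u _"])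
  then have "U \<longlonglongrightarrow> 0"
    by (intro tendsto_sandwich[OF _ _ tendsto_const CA]) auto
  moreover have "(\<lambda>n. \<Sum>k<n. A (Suc k)) \<longlonglongrightarrow> (\<Sum>k. A (Suc k))"
    by (rule summable_LIMSEQ) simp
  ultimately have "(\<lambda>n. (\<Sum>k<n. A (Suc k)) + U n) \<longlonglongrightarrow> (\<Sum>k. A (Suc k)) + 0"
    by (intro tendsto_add)
  then show ?thesis
    unfolding partial_sums by (simp add: LIMSEQ_const_iff A_def)
qed

section \<open>The time before absorption as a sum of survival probabilities\<close>

lemma less_time_before_absorption_iff:
  "enat t < time_before_absorption X \<omega> \<longleftrightarrow> (\<forall>n\<le>t. X (Suc n) \<omega> \<noteq> None)"
proof -
  have "enat t < time_before_absorption X \<omega> \<longleftrightarrow> enat (Suc t) \<le> time_before_absorption X \<omega>"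
    by (simp add: Suc_ile_eq)
  also have "\<dots> \<longleftrightarrow> (\<forall>n. X (Suc n) \<omega> = None \<longrightarrow> Suc t \<le> n)"
    unfolding time_before_absorption_def by (auto simp: le_Inf_iff)
  also have "\<dots> \<longleftrightarrow> (\<forall>n\<le>t. X (Suc n) \<omega> \<noteq> None)"
    unfolding Suc_le_eq not_le[symmetric] by blast
  finally show ?thesis .
qed

text \<open>
  The tail formula for the mean of a variable with values in the natural numbers and infinity. Time 0
  may be added to the times of survival because the particle starts alive almost surely.
\<close>

lemma expected_time_before_absorption_eq_suminf:
  assumes mc: "markov_chain K (Some x0) M X"
  shows "expected_time_before_absorption M X =
    (\<Sum>t. emeasure M {\<omega> \<in> space M. \<forall>k\<le>Suc t. X k \<omega> \<in> range Some})"
proof -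
  have meas[measurable]: "\<And>n. X n \<in> measurable M (count_space UNIV)"
    using mc by (simp add: markov_chain_def)
  have "(\<lambda>\<omega>. INF n. if X (Suc n) \<omega> = None then enat n else \<infinity>) \<in> measurable M (count_space UNIV)"
    by measurable
  moreover have "time_before_absorption X = (\<lambda>\<omega>. INF n. if X (Suc n) \<omega> = None then enat n else \<infinity>)"
    unfolding time_before_absorption_def 
    by (auto intro!: ext antisym Inf_greatest INF_greatest intro: Inf_lower INF_lower2)
  ultimately have "time_before_absorption X \<in> measurable M (count_space UNIV)" by simp
  then have "expected_time_before_absorption M X =
      (\<Sum>t. emeasure M {\<omega> \<in> space M. enat t < time_before_absorption X \<omega>})"
    unfolding expected_time_before_absorption_def by (rule nn_integral_enat_function)
  also have "\<dots> = (\<Sum>t. emeasure M {\<omega> \<in> space M. \<forall>k\<le>Suc t. X k \<omega> \<in> range Some})"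
  proof (intro suminf_cong emeasure_eq_AE)
    fix t
    have "AE \<omega> in M. X 0 \<omega> = Some x0" using mc by (simp add: markov_chain_def)
    then show "AE \<omega> in M. \<omega> \<in> {\<omega> \<in> space M. enat t < time_before_absorption X \<omega>} \<longleftrightarrow>
        \<omega> \<in> {\<omega> \<in> space M. \<forall>k\<le>Suc t. X k \<omega> \<in> range Some}"
    proof eventually_elim
      case (elim \<omega>)
      have "(\<forall>k\<le>Suc t. X k \<omega> \<in> range Some) \<longleftrightarrow> (\<forall>n\<le>t. X (Suc n) \<omega> \<noteq> None)"
        using elim by (auto simp: notin_range_Some less_Suc_eq_le All_less_Suc2 simp flip: less_Suc_eq_le)
      then show ?case by (simp add: less_time_before_absorption_iff)
    qed
    show "{\<omega> \<in> space M. enat t < time_before_absorption X \<omega>} \<in> sets M"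
      unfolding less_time_before_absorption_iff by measurable
    show "{\<omega> \<in> space M. \<forall>k\<le>Suc t. X k \<omega> \<in> range Some} \<in> sets M"
      unfolding pred_def[symmetric] by (rule pred_confined[OF meas])
  qed
  finally show ?thesis .
qed

section \<open>The characteristic root\<close>

text \<open>
  Since \<open>1 - r = p + q + s\<close> exceeds \<open>p + q\<close>, the discriminant exceeds
  \<open>(p + q)\<^sup>2 - 4 * p * q\<close>, which is the square on the left.
\<close>

lemma xi1_discriminant_gt:
  fixes p q r s :: real
  assumes "p > 0" "q > 0" "s > 0" "p + q + r + s = 1"
  shows "(p - q)\<^sup>2 < (1 - r)\<^sup>2 - 4 * p * q"
proof -
  have "(p + q)\<^sup>2 < (1 - r)\<^sup>2" using assms by (intro power_strict_mono) auto
  then show ?thesis by (simp add: power2_eq_square algebra_simps)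
qed

lemma xi1_root:
  assumes "p > 0" "q > 0" "s > 0" "p + q + r + s = 1"
  shows "q * (xi1 p q r)\<^sup>2 + p = (1 - r) * xi1 p q r"
proof -
  have "(1 - r)\<^sup>2 - 4 * p * q \<ge> 0"
    using xi1_discriminant_gt[OF assms] zero_le_power2[of "p - q"] by linarith
  then have "(2 * q * xi1 p q r - (1 - r))\<^sup>2 = (1 - r)\<^sup>2 - 4 * p * q"
    using assms by (simp add: xi1_def)
  then have "4 * q * (q * (xi1 p q r)\<^sup>2 + p) = 4 * q * ((1 - r) * xi1 p q r)"
    by (simp add: power2_eq_square algebra_simps)
  then show ?thesis using assms by simp
qed

text \<open>The numerator exceeds \<open>p + q + \<bar>p - q\<bar>\<close>, which is at least \<open>2 * q\<close>.\<close>

lemma xi1_gt_1: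
  assumes "p > 0" "q > 0" "s > 0" "p + q + r + s = 1"
  shows "xi1 p q r > 1"
proof -
  have "\<bar>p - q\<bar> < sqrt ((1 - r)\<^sup>2 - 4 * p * q)"
    using xi1_discriminant_gt[OF assms] by (intro real_less_rsqrt) simp
  then have "2 * q < (1 - r) + sqrt ((1 - r)\<^sup>2 - 4 * p * q)"
    using assms by linarith
  then show ?thesis using assms by (simp add: xi1_def)
qed

section \<open>The closed form solves the first-step equations\<close>

definition time_formula ::
  "real \<Rightarrow> real \<Rightarrow> real \<Rightarrow> real \<Rightarrow> real \<Rightarrow> real \<Rightarrow> real \<Rightarrow> nat \<Rightarrow> real"
where
  "time_formula p q r s p0 r0 s0 i = (1 - s) / s
      - inverse (v1 p q r p0 r0) * (1 - s0 / s) * xi1 p q r powi (1 - int i)"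

context
  fixes p q r s p0 r0 s0 :: real
  assumes pos: "p > 0" "q > 0" "s > 0" "r \<ge> 0" and sum_1: "p + q + r + s = 1"
    and pos0: "p0 > 0" "s0 > 0" "r0 \<ge> 0" and sum_1_0: "p0 + r0 + s0 = 1"
begin

abbreviation (input) "\<xi> \<equiv> xi1 p q r"
abbreviation (input) "v \<equiv> v1 p q r p0 r0"
abbreviation (input) "m \<equiv> time_formula p q r s p0 r0 s0"
abbreviation (input) "B \<equiv> inverse v * (1 - s0 / s)"

lemma v1_neg: "v < 0"
proof -
  have "p0 < 1 - r0" using pos0 sum_1_0 by linarith
  also have "\<dots> \<le> (1 - r0) * \<xi>"
    using xi1_gt_1[OF pos(1-3) sum_1] pos0 sum_1_0 by simp
  finally show ?thesis by (simp add: v1_def)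
qed

lemma time_formula_altdef: "m i = (1 - s) / s - B * (\<xi> / \<xi> ^ i)"
  using xi1_gt_1[OF pos(1-3) sum_1] by (simp add: time_formula_def power_int_diff)

text \<open>
  Substituting the closed form, the two sides differ by a constant part, which vanishes by the
  choice \<open>c = (1 - s) / s\<close>, and a multiple of the characteristic polynomial at its root.
\<close>

lemma time_formula_Suc:
  "m (Suc i) = p * (1 + m (Suc (Suc i))) + q * (1 + m i) + r * (1 + m (Suc i))"
proof -
  have gt: "\<xi> > 1" by (rule xi1_gt_1[OF pos(1-3) sum_1])
  define c d where "c = (1 - s) / s" and "d = B * (\<xi> / \<xi> ^ Suc (Suc i))"
  have m: "m (Suc (Suc i)) = c - d" "m (Suc i) = c - d * \<xi>" "m i = c - d * \<xi>\<^sup>2"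
    using gt by (simp_all add: time_formula_altdef c_def d_def power2_eq_square)
  have "q * \<xi>\<^sup>2 + p - (1 - r) * \<xi> = 0"
    using xi1_root[OF pos(1-3) sum_1] by simp
  moreover have "p + q + r = 1 - s" using sum_1 by simp
  moreover have "p * (1 + m (Suc (Suc i))) + q * (1 + m i) + r * (1 + m (Suc i)) - m (Suc i) =
      (p + q + r) - (1 - (p + q + r)) * c - d * (q * \<xi>\<^sup>2 + p - (1 - r) * \<xi>)"
    unfolding m by (simp add: algebra_simps)
  ultimately have "p * (1 + m (Suc (Suc i))) + q * (1 + m i) + r * (1 + m (Suc i)) - m (Suc i) =
      (1 - s) - (1 - (1 - s)) * c - d * 0"
    by (simp only:)
  also have "\<dots> = 0" using pos by (simp add: c_def)
  finally show ?thesis by simp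
qed

text \<open>
  The coefficient of the exponential term is exactly what the boundary state requires: there the
  exponential part contributes \<open>B * v\<close>, which has to balance the defect \<open>1 - s0 / s\<close> of the constant part.
\<close>

lemma time_formula_0: "m 0 = p0 * (1 + m 1) + r0 * (1 + m 0)"
proof -
  have gt: "\<xi> > 1" by (rule xi1_gt_1[OF pos(1-3) sum_1])
  define b c where "b = B" and "c = (1 - s) / s"
  have m: "m 1 = c - b" "m 0 = c - b * \<xi>"
    using gt by (simp_all add: time_formula_altdef b_def c_def)
  have "b * v = 1 - s0 / s" using v1_neg by (simp add: b_def)
  then have "b * (p0 - (1 - r0) * \<xi>) = 1 - s0 / s" by (simp only: v1_def)
  moreover have "(1 - r0 - p0) * c = s0 / s - s0"
  proof -
    have eq: "1 - r0 - p0 = s0" using sum_1_0 by simp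
    show ?thesis unfolding eq c_def using pos by (simp add: field_simps)
  qed
  moreover have "p0 + r0 = 1 - s0" using sum_1_0 by simp
  moreover have "p0 * (1 + m 1) + r0 * (1 + m 0) - m 0 =
      (p0 + r0) - (1 - r0 - p0) * c - b * (p0 - (1 - r0) * \<xi>)"
    unfolding m by (simp add: algebra_simps)
  ultimately have "p0 * (1 + m 1) + r0 * (1 + m 0) - m 0 =
      (1 - s0) - (s0 / s - s0) - (1 - s0 / s)"
    by (simp only:)
  then show ?thesis by simp
qed

text \<open>
  The powers of \<open>1 / \<xi>\<close> are at most 1. With the smaller root of \<open>q * x\<^sup>2 - (1 - r) * x + p\<close> in place
  of \<open>\<xi>\<close>, which lies below 1, they would be unbounded.
\<close>

lemma time_formula_bound: "m i \<le> (1 - s) / s + \<bar>B\<bar> * \<xi>"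
proof -
  have "\<xi> / \<xi> ^ i \<le> \<xi>" "0 \<le> \<xi> / \<xi> ^ i"
    using xi1_gt_1[OF pos(1-3) sum_1] by (simp_all add: divide_le_eq)
  then have "\<bar>B * (\<xi> / \<xi> ^ i)\<bar> \<le> \<bar>B\<bar> * \<xi>"
    unfolding abs_mult by (intro mult_left_mono) auto
  then show ?thesis unfolding time_formula_altdef by linarith
qed

text \<open>
  Nonnegativity allows the first-step equation to be read in the extended nonnegative reals. Only a
  positive coefficient \<open>B\<close> is a concern; the formula is then smallest at state 0, where it is
  nonnegative by \<open>B * \<xi> \<le> (1 - s) / s\<close>.
\<close>

lemma time_formula_nonneg: "m i \<ge> 0"
proof -
  have gt: "\<xi> > 1" by (rule xi1_gt_1[OF pos(1-3) sum_1])
  have s: "s < 1" "s0 < 1" using pos pos0 sum_1 sum_1_0 by linarith+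
  have range: "0 \<le> \<xi> / \<xi> ^ i" "\<xi> / \<xi> ^ i \<le> \<xi>"
    using gt by (simp_all add: divide_le_eq)
  have "B * (\<xi> / \<xi> ^ i) \<le> (1 - s) / s"
  proof (cases "B \<le> 0")
    case True
    then have "B * (\<xi> / \<xi> ^ i) \<le> 0" using range(1) by (rule mult_nonpos_nonneg)
    also have "0 \<le> (1 - s) / s" using pos s by simp
    finally show ?thesis .
  next
    case False
    then have "0 \<le> B" by simp
    then have "B * (\<xi> / \<xi> ^ i) \<le> B * \<xi>" by (rule mult_left_mono[OF range(2)])
    also have "B * \<xi> \<le> (1 - s) / s"
    proof -
      have r0: "r0 = 1 - p0 - s0" using sum_1_0 by simp
      \<comment> \<open>Cleared of the denominator \<open>- s * v\<close>, the claim is that this sum is nonnegative.\<close>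
      have "0 \<le> (1 - s) * p0 * (\<xi> - 1) + \<xi> * s * (1 - s0)"
        using gt s pos pos0 by (intro add_nonneg_nonneg mult_nonneg_nonneg) auto
      also have "\<dots> = (1 - s) * (- v) - (s0 - s) * \<xi>"
        unfolding v1_def r0 by (simp add: algebra_simps)
      finally have "(s0 - s) * \<xi> \<le> (1 - s) * (- v)" by simp
      then have "(s0 - s) * \<xi> / (s * (- v)) \<le> (1 - s) * (- v) / (s * (- v))"
        using pos v1_neg by (intro divide_right_mono) (auto simp: mult_nonneg_nonpos)
      moreover have "(s0 - s) * \<xi> / (s * (- v)) = B * \<xi>"
        using pos v1_neg by (simp add: field_simps)
      moreover have "(1 - s) * (- v) / (s * (- v)) = (1 - s) / s"
        using v1_neg by simp
      ultimately show ?thesis by simp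
    qed
    finally show ?thesis .
  qed
  then show ?thesis by (simp add: time_formula_altdef)
qed

lemma pqrs_trans_nonneg: "pqrs_trans p q r s p0 r0 s0 x y \<ge> 0"
proof (cases x)
  case (Some i)
  then show ?thesis using pos pos0 by (cases i) simp_all
qed simp

text \<open>
  The two recurrences in the form that the first-step analysis asks for: at most three states are
  reachable in one step, so that the integral is a finite sum.
\<close>

lemma time_formula_recursion:
  "ennreal (m i) = (\<integral>\<^sup>+y. ennreal (pqrs_trans p q r s p0 r0 s0 (Some i) y) *
     (1 + ennreal (m (the y))) \<partial>count_space (range Some))"
proof -
  have split: "ennreal a * (1 + ennreal (m k)) = ennreal (a * (1 + m k))" if "a \<ge> 0" for a k
    using that time_formula_nonneg[of k]
    by (simp add: ennreal_mult flip: ennreal_1 ennreal_plus)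
  let ?f = "\<lambda>y. ennreal (pqrs_trans p q r s p0 r0 s0 (Some i) y) * (1 + ennreal (m (the y)))"
  show ?thesis
  proof (cases i)
    case 0
    have "(\<integral>\<^sup>+y. ?f y \<partial>count_space (range Some)) = (\<Sum>y\<in>{Some 0, Some 1}. ?f y)"
      by (rule nn_integral_count_space') (auto simp: 0)
    also have "\<dots> = ennreal (r0 * (1 + m 0)) + ennreal (p0 * (1 + m 1))"
      using pos0 by (simp add: 0 split)
    also have "\<dots> = ennreal (p0 * (1 + m 1) + r0 * (1 + m 0))"
      using pos0 time_formula_nonneg[of 0] time_formula_nonneg[of 1]
      by (subst ennreal_plus) (auto simp: add.commute)
    also have "\<dots> = ennreal (m 0)" by (simp only: time_formula_0[symmetric])
    finally show ?thesis unfolding 0 by simp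
  next
    case (Suc n)
    have "(\<integral>\<^sup>+y. ?f y \<partial>count_space (range Some)) =
        (\<Sum>y\<in>{Some (Suc (Suc n)), Some n, Some (Suc n)}. ?f y)"
      by (rule nn_integral_count_space') (auto simp: Suc)
    also have "\<dots> = ennreal (p * (1 + m (Suc (Suc n)))) +
        (ennreal (q * (1 + m n)) + ennreal (r * (1 + m (Suc n))))"
    proof -
      have "?f (Some (Suc (Suc n))) = ennreal (p * (1 + m (Suc (Suc n))))"
        "?f (Some n) = ennreal (q * (1 + m n))" "?f (Some (Suc n)) = ennreal (r * (1 + m (Suc n)))"
        using pos by (simp_all add: Suc split)
      then show ?thesis by (simp del: pqrs_trans.simps)
    qed
    also have "\<dots> = ennreal (p * (1 + m (Suc (Suc n))) + q * (1 + m n) + r * (1 + m (Suc n)))"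
      using pos time_formula_nonneg by (simp add: add.assoc ennreal_plus)
    also have "\<dots> = ennreal (m (Suc n))" by (simp only: time_formula_Suc[symmetric])
    finally show ?thesis unfolding Suc by simp
  qed
qed

end

section \<open>The mean time before absorption\<close>

theorem theorem6:
  fixes p q r s p0 r0 s0 :: real
    and i :: nat
    and M :: "'w measure"
    and X :: "nat \<Rightarrow> 'w \<Rightarrow> nat option"
  assumes "p > 0" and "q > 0" and "s > 0" and "r \<ge> 0" and "p + q + r + s = 1"
    and "p0 > 0" and "s0 > 0" and "r0 \<ge> 0" and "p0 + r0 + s0 = 1"
    and "markov_chain (pqrs_trans p q r s p0 r0 s0) (Some i) M X"
  shows "enn2ereal (expected_time_before_absorption M X) =
    ereal ((1 - s) / s
      - inverse (v1 p q r p0 r0) * (1 - s0 / s) * xi1 p q r powi (1 - int i))"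
proof -
  note params = assms(1-9)
  let ?m = "time_formula p q r s p0 r0 s0"
  let ?C = "(1 - s) / s + \<bar>inverse (v1 p q r p0 r0) * (1 - s0 / s)\<bar> * xi1 p q r"
  have "expected_time_before_absorption M X =
      (\<Sum>t. emeasure M {\<omega> \<in> space M. \<forall>k\<le>Suc t. X k \<omega> \<in> range Some})"
    by (rule expected_time_before_absorption_eq_suminf[OF assms(10)])
  also have "\<dots> = ennreal (?m (the (Some i)))"
  proof (rule suminf_confined_prob[OF assms(10)])
    show "pqrs_trans p q r s p0 r0 s0 x y \<ge> 0" for x y
      by (rule pqrs_trans_nonneg[OF params])
    show "ennreal (?m (the x)) \<le> ennreal ?C" for x
      by (intro ennreal_leI time_formula_bound[OF params])
    fix x :: "nat option" assume "x \<in> range Some"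
    then obtain k where "x = Some k" by blast
    then show "ennreal (?m (the x)) = (\<integral>\<^sup>+y. ennreal (pqrs_trans p q r s p0 r0 s0 x y) *
        (1 + ennreal (?m (the y))) \<partial>count_space (range Some))"
      using time_formula_recursion[OF params, of k] by (simp only: option.sel)
  next
    show "countable (range Some :: nat option set)" by (rule countable_image) simp
    show "Some i \<in> range Some" by (rule rangeI)
  qed
  finally show ?thesis
    using time_formula_nonneg[OF params, of i] 
    by (simp only: option.sel enn2ereal_ennreal time_formula_def)
qed

end
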